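(* Let $n\ge1$, $0\le m<n$, let $a_1,\dots,a_n$ be nonnegative integers, and fix $r\in\{1,\dots,n\}$. Let $M=\{r+1,\dots,r+m\}$, where indices are understood modulo $n$ (as elements of $\{1,\dots,n\}$). For $1\le i<j\le n$ define $a_i^*(j)=a_i+\chi(j\in M,\ i=r)$ and $a_j^*(i)=a_j+\chi(i\in M,\ j=r)$. Then \[ \mathrm{CT}\Bigg[\prod_{1\le i<j\le n}\left(\frac{x_i}{x_j}\right)_{a_i^*(j)}\left(\frac{qx_j}{x_i}\right)_{a_j^*(i)}\Bigg]=\frac{1-q^{1+|\mathbf a|}}{1-q^{1+\sum_{v\notin M}a_v}}\begin{bmatrix}|\mathbf a|\\ \mathbf a\end{bmatrix}_q. \]
   Context: $q$ and $x_1,\dots,x_n$ are independent indeterminates; $\mathrm{CT}$ denotes the constant term with respect to $x_1,\dots,x_n$ of a Laurent polynomial with coefficients in $\mathbb{Q}(q)$. $(t)_k=(1-t)(1-tq)\cdots(1-tq^{k-1})$, $(t)_0=1$. $|\mathbf a|=a_1+\dots+a_n$, $\begin{bmatrix}|\mathbf a|\\ \mathbf a\end{bmatrix}_q=\frac{(q)_{|\mathbf a|}}{(q)_{a_1}\cdots(q)_{a_n}}$, and $\chi(S)$ is $1$ if $S$ is true and $0$ otherwise. *)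

theory Defs
  imports
    "HOL-Library.Poly_Mapping"
    "HOL-Computational_Algebra.Polynomial"
    "HOL-Computational_Algebra.Fraction_Field"
begin

type_synonym ratfun = "rat poly fract"

text \<open>
  Laurent polynomials over \<open>\<rat>(q)\<close> in indeterminates \<open>x\<^sub>i\<close> indexed by the naturals.
  An exponent vector is a finitely supported function into the integers, so that the
  convolution product on \<open>Poly_Mapping\<close> is the product of Laurent polynomials.
\<close>

type_synonym laurent = "(nat \<Rightarrow>\<^sub>0 int) \<Rightarrow>\<^sub>0 ratfun"

definition q_ind :: ratfun where
  "q_ind = Fract [:0, 1:] 1"

definition const_laurent :: "ratfun \<Rightarrow> laurent" where
  "const_laurent c = Poly_Mapping.single 0 c"

definition x_quot :: "nat \<Rightarrow> nat \<Rightarrow> laurent" where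
  "x_quot i j = Poly_Mapping.single (Poly_Mapping.single i 1 - Poly_Mapping.single j 1) 1"

definition CT :: "laurent \<Rightarrow> ratfun" where
  "CT f = Poly_Mapping.lookup f 0"

definition qpoch :: "'a::comm_ring_1 \<Rightarrow> 'a \<Rightarrow> nat \<Rightarrow> 'a" where
  "qpoch q t k = (\<Prod>s<k. 1 - t * q ^ s)"

definition qmultinomial :: "nat \<Rightarrow> (nat \<Rightarrow> nat) \<Rightarrow> ratfun" where
  "qmultinomial n a =
     qpoch q_ind q_ind (\<Sum>i=1..n. a i) / (\<Prod>i=1..n. qpoch q_ind q_ind (a i))"

text \<open>\<open>cyc_index n k\<close> is the representative of \<open>k \<ge> 1\<close> modulo \<open>n\<close> in \<open>{1..n}\<close>.\<close>

definition cyc_index :: "nat \<Rightarrow> nat \<Rightarrow> nat" where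
  "cyc_index n k = (k - 1) mod n + 1"

definition cyc_block :: "nat \<Rightarrow> nat \<Rightarrow> nat \<Rightarrow> nat set" where
  "cyc_block n r m = cyc_index n ` {r+1..r+m}"

definition astar :: "(nat \<Rightarrow> nat) \<Rightarrow> nat \<Rightarrow> nat set \<Rightarrow> nat \<Rightarrow> nat \<Rightarrow> nat" where
  "astar a r M i j = a i + of_bool (j \<in> M \<and> i = r)"

end

theory Submission
  imports Defs "HOL-Library.FuncSet"
begin

text \<open>
  The proof follows the Combinatorial Nullstellensatz approach of Karolyi and Nagy to the q-Dyson
  theorem. If \<open>f\<close> is homogeneous of degree \<open>0\<close> and has degree at most \<open>d\<^sub>i\<close> in \<open>1/x\<^sub>i\<close>, then
  interpolation in each \<open>1/x\<^sub>i\<close>, extrapolated to \<open>1/x\<^sub>i = 0\<close>, expresses the constant term of \<open>f\<close> as a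
  weighted sum of its values on a grid with more than \<open>d\<^sub>i\<close> nodes in direction \<open>i\<close>. The nodes are
  consecutive powers of \<open>q\<close>. They start at \<open>q\<close> for \<open>i \<le> r\<close> and at \<open>1\<close> for \<open>i > r\<close>, which has the
  effect of rotating the indices so that \<open>r\<close> becomes the last one and \<open>M\<close> becomes \<open>{1..m}\<close>.
  In the rotated indices \<open>k\<close>, with exponents \<open>b\<^sub>k\<close> and \<open>x\<^sub>k\<close> equal to \<open>q^\<beta>\<^sub>k\<close> times the first node, the product
  vanishes unless \<open>\<beta>\<^sub>k = b\<^sub>1 + \<dots> + b\<^sub>k\<^sub>-\<^sub>1\<close> for all \<open>k\<close>: sorting the indices by \<open>\<beta>\<close>, the gaps are so
  large that every other order exceeds the range of the grid. The value at the surviving point is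
  a telescoping product.
\<close>

subsection \<open>Constant terms by interpolation\<close>

text \<open>The Lagrange basis polynomial \<open>L y\<close> takes the value of the product of
  \<open>z / (z - y)\<close> at 0, and the degree bound makes the interpolant equal to
  \<open>p\<close>.\<close>

lemma lagrange_interpolation_at_0:
  fixes A :: "'k::field set" and p :: "'k poly"
  assumes "finite A" "degree p < card A"
  shows "(\<Sum>y\<in>A. poly p y * (\<Prod>z\<in>A - {y}. z / (z - y))) = poly p 0"
proof -
  define L where "L y = (\<Prod>z\<in>A - {y}. smult (1 / (y - z)) [:- z, 1:])" for y
  have L: "poly (L y) x = (\<Prod>z\<in>A - {y}. (x - z) / (y - z))" for x y
    by (simp add: L_def poly_prod diff_divide_distrib)
  have deg: "degree (L y) < card A" if "y \<in> A" for y
  proof -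
    have "degree (L y) \<le> (\<Sum>z\<in>A - {y}. degree (smult (1 / (y - z)) [:- z, 1:]))"
      unfolding L_def using degree_prod_sum_le[of "A - {y}"] assms(1) by (metis (no_types, lifting) comp_apply finite_Diff sum.cong)
    also have "\<dots> \<le> (\<Sum>z\<in>A - {y}. 1)"
      by (rule sum_mono) simp
    also have "\<dots> < card A"
      using that assms(1) card_Diff1_less[of A y] by simp
    finally show ?thesis .
  qed
  have node: "poly (L y) x = (if x = y then 1 else 0)" if "x \<in> A" for x y
  proof (cases "x = y")
    case True
    then show ?thesis unfolding L by (auto intro!: prod.neutral split: if_splits)
  next
    case False
    then show ?thesis using that assms(1) unfolding L by (auto intro!: prod_zero bexI[of _ x])
  qed
  define s where "s = (\<Sum>y\<in>A. smult (poly p y) (L y))"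
  have "s = p"
  proof (rule poly_eqI_degree[where A = A])
    fix x assume "x \<in> A"
    then show "poly s x = poly p x"
      using assms(1) by (simp add: s_def poly_sum node if_distrib cong: if_cong)
  next
    have "degree s \<le> card A - 1"
      unfolding s_def
    proof (rule degree_sum_le[OF assms(1)])
      fix y assume "y \<in> A"
      show "degree (smult (poly p y) (L y)) \<le> card A - 1"
        using deg[OF \<open>y \<in> A\<close>] degree_smult_le[of "poly p y" "L y"] by linarith
    qed
    then show "card A > degree s" using assms(2) by linarith
  qed (use assms in auto)
  moreover have "poly s 0 = (\<Sum>y\<in>A. poly p y * (\<Prod>z\<in>A - {y}. z / (z - y)))"
  proof -
    have "(0 - z) / (y - z) = z / (z - y)" for y z :: 'k
      by (metis diff_0 minus_diff_eq minus_divide_divide)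
    then show ?thesis by (simp add: s_def poly_sum L)
  qed
  ultimately show ?thesis by simp
qed

text \<open>Passing to the inverse nodes turns \<open>c powi (- int l)\<close> into the monomial
  \<open>y ^ l\<close> and the Lagrange weights at 0 into products of
  \<open>1 / (1 - z / c)\<close>. Extrapolation to 0 then kills every monomial except the constant
  one.\<close>

lemma weighted_node_power_sum:
  fixes A :: "'k::field set"
  assumes "finite A" "0 \<notin> A" "l < card A"
  shows "(\<Sum>c\<in>A. c powi (- int l) * (\<Prod>z\<in>A - {c}. 1 / (1 - z / c))) = (if l = 0 then 1 else 0)"
proof -
  have inj: "inj_on inverse A" by (auto intro: inj_onI)
  have "(\<Sum>y\<in>inverse ` A. poly (monom 1 l) y * (\<Prod>z\<in>inverse ` A - {y}. z / (z - y)))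
      = poly (monom 1 l) (0::'k)"
    using assms inj by (intro lagrange_interpolation_at_0)
      (auto simp: card_image degree_monom_eq)
  also have "(\<Sum>y\<in>inverse ` A. poly (monom 1 l) y * (\<Prod>z\<in>inverse ` A - {y}. z / (z - y)))
      = (\<Sum>c\<in>A. inverse c ^ l * (\<Prod>z\<in>inverse ` A - {inverse c}. z / (z - inverse c)))"
    by (simp add: sum.reindex[OF inj] poly_monom)
  also have "\<dots> = (\<Sum>c\<in>A. c powi (- int l) * (\<Prod>z\<in>A - {c}. 1 / (1 - z / c)))"
  proof (rule sum.cong[OF refl])
    fix c assume c: "c \<in> A"
    have "inverse ` A - {inverse c} = inverse ` (A - {c})" by auto
    moreover have "inj_on inverse (A - {c})" by (rule inj_on_subset[OF inj]) auto
    ultimately have "(\<Prod>z\<in>inverse ` A - {inverse c}. z / (z - inverse c))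
        = (\<Prod>z\<in>A - {c}. inverse z / (inverse z - inverse c))"
      by (simp add: prod.reindex)
    also have "\<dots> = (\<Prod>z\<in>A - {c}. 1 / (1 - z / c))"
    proof (rule prod.cong[OF refl])
      fix z assume z: "z \<in> A - {c}"
      then have "z \<noteq> 0" "c \<noteq> 0" "z \<noteq> c" using c assms(2) by auto
      then show "inverse z / (inverse z - inverse c) = 1 / (1 - z / c)"
        by (simp add: field_simps)
    qed
    finally show "inverse c ^ l * (\<Prod>z\<in>inverse ` A - {inverse c}. z / (z - inverse c))
        = c powi (- int l) * (\<Prod>z\<in>A - {c}. 1 / (1 - z / c))"
      by (simp add: power_int_minus power_inverse)
  qed
  finally show ?thesis by (simp add: poly_monom power_0_left)
qed

section \<open>Evaluation of Laurent polynomials at points\<close>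

definition laurent_eval ::
  "'v set \<Rightarrow> ('v \<Rightarrow> 'k::field) \<Rightarrow> (('v \<Rightarrow>\<^sub>0 int) \<Rightarrow>\<^sub>0 'k) \<Rightarrow> 'k" where
  "laurent_eval I c f = (\<Sum>e\<in>Poly_Mapping.keys f.
     Poly_Mapping.lookup f e * (\<Prod>i\<in>I. c i powi Poly_Mapping.lookup e i))"

lemma laurent_eval_superset:
  assumes "finite K" "Poly_Mapping.keys f \<subseteq> K"
  shows "laurent_eval I c f = (\<Sum>e\<in>K.
     Poly_Mapping.lookup f e * (\<Prod>i\<in>I. c i powi Poly_Mapping.lookup e i))"
  unfolding laurent_eval_def using assms
  by (intro sum.mono_neutral_left) (auto simp: in_keys_iff)

lemma laurent_eval_add: "laurent_eval I c (f + g) = laurent_eval I c f + laurent_eval I c g"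
  using Poly_Mapping.keys_add[of f g]
  by (subst (1 2 3) laurent_eval_superset[where K = "Poly_Mapping.keys f \<union> Poly_Mapping.keys g"])
     (auto simp: lookup_add algebra_simps sum.distrib)

lemma laurent_eval_diff: "laurent_eval I c (f - g) = laurent_eval I c f - laurent_eval I c g"
  using laurent_eval_add[of I c "f - g" g] by simp

lemma laurent_eval_sum: "laurent_eval I c (sum f K) = (\<Sum>k\<in>K. laurent_eval I c (f k))"
proof (cases "finite K")
  case True
  then show ?thesis
    by (induction K rule: finite_induct) (auto simp: laurent_eval_add laurent_eval_def[of I c 0])
qed (simp add: laurent_eval_def)

lemma laurent_eval_single:
  "laurent_eval I c (Poly_Mapping.single e u) = u * (\<Prod>i\<in>I. c i powi Poly_Mapping.lookup e i)"
  by (subst laurent_eval_superset[where K = "{e}"]) auto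

lemma poly_mapping_sum_single:
  "f = (\<Sum>e\<in>Poly_Mapping.keys f. Poly_Mapping.single e (Poly_Mapping.lookup f e))"
  by (rule poly_mapping_eqI) (auto simp: lookup_sum lookup_single when_def in_keys_iff)

text \<open>Both sides are bilinear, so monomials suffice. There \<open>powi\<close> turns sums of
  exponents into products, including exponents of mixed sign, because the coordinates are
  nonzero.\<close>

lemma laurent_eval_mult:
  assumes "\<And>i. i \<in> I \<Longrightarrow> c i \<noteq> 0"
  shows "laurent_eval I c (f * g) = laurent_eval I c f * laurent_eval I c g"
proof -
  let ?s = Poly_Mapping.single and ?l = Poly_Mapping.lookup
  have mono: "laurent_eval I c (?s e u * ?s e' u') = laurent_eval I c (?s e u) * laurent_eval I c (?s e' u')"
    for e e' u u'
  proof -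
    have "(\<Prod>i\<in>I. c i powi ?l (e + e') i) = (\<Prod>i\<in>I. c i powi ?l e i * c i powi ?l e' i)"
      using assms by (intro prod.cong) (auto simp: lookup_add power_int_add)
    then show ?thesis by (simp add: mult_single laurent_eval_single prod.distrib)
  qed
  have "laurent_eval I c (f * g) = laurent_eval I c
     ((\<Sum>e\<in>Poly_Mapping.keys f. ?s e (?l f e)) * (\<Sum>e\<in>Poly_Mapping.keys g. ?s e (?l g e)))"
    using poly_mapping_sum_single[of f] poly_mapping_sum_single[of g] by simp
  also have "\<dots> = laurent_eval I c (\<Sum>e\<in>Poly_Mapping.keys f. ?s e (?l f e))
      * laurent_eval I c (\<Sum>e\<in>Poly_Mapping.keys g. ?s e (?l g e))"
    by (simp add: sum_product laurent_eval_sum mono)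
  finally show ?thesis
    using poly_mapping_sum_single[of f] poly_mapping_sum_single[of g] by simp
qed

lemma laurent_eval_one: "laurent_eval I c 1 = 1"
  by (simp add: laurent_eval_def)

lemma laurent_eval_prod:
  assumes "\<And>i. i \<in> I \<Longrightarrow> c i \<noteq> 0"
  shows "laurent_eval I c (prod f K) = (\<Prod>k\<in>K. laurent_eval I c (f k))"
  by (induction K rule: infinite_finite_induct)
     (auto simp: laurent_eval_one laurent_eval_mult[OF assms])

text \<open>Degree zero makes one-sided bounds on the exponents sufficient: an exponent vector with
  sum zero is either zero or has a negative entry, and only negative entries are tested by the
  interpolation. \<open>d i\<close> bounds the pole order in the variable \<open>i\<close>.\<close>

definition deg0_bounded_below ::
  "'v set \<Rightarrow> ('v \<Rightarrow> nat) \<Rightarrow> (('v \<Rightarrow>\<^sub>0 int) \<Rightarrow>\<^sub>0 'k::zero) \<Rightarrow> bool" where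
  "deg0_bounded_below I d f \<longleftrightarrow> (\<forall>e\<in>Poly_Mapping.keys f.
     Poly_Mapping.keys e \<subseteq> I \<and> (\<Sum>i\<in>I. Poly_Mapping.lookup e i) = 0 \<and>
     (\<forall>i\<in>I. - int (d i) \<le> Poly_Mapping.lookup e i))"

text \<open>The weighted sum over the grid factors coordinatewise on each monomial. A nonzero
  exponent vector has a negative entry, whose coordinate sum is zero, so only the monomial with
  exponent 0 survives.\<close>

lemma lookup_0_eq_sum_laurent_eval:
  fixes f :: "('v \<Rightarrow>\<^sub>0 int) \<Rightarrow>\<^sub>0 'k::field"
  assumes "finite I" "deg0_bounded_below I d f"
    and A: "\<And>i. i \<in> I \<Longrightarrow> finite (A i) \<and> 0 \<notin> A i \<and> d i < card (A i)"
  shows "Poly_Mapping.lookup f 0 = (\<Sum>c\<in>PiE I A. laurent_eval I c f *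
           (\<Prod>i\<in>I. \<Prod>z\<in>A i - {c i}. 1 / (1 - z / c i)))"
proof -
  let ?l = Poly_Mapping.lookup and ?K = "Poly_Mapping.keys f"
  define w where "w i u = (\<Prod>z\<in>A i - {u}. 1 / (1 - z / u))" for i u
  have "(\<Sum>c\<in>PiE I A. laurent_eval I c f * (\<Prod>i\<in>I. w i (c i)))
      = (\<Sum>c\<in>PiE I A. \<Sum>e\<in>?K. ?l f e * (\<Prod>i\<in>I. c i powi ?l e i * w i (c i)))"
    by (simp add: laurent_eval_def sum_distrib_right prod.distrib mult.assoc)
  also have "\<dots> = (\<Sum>e\<in>?K. ?l f e * (\<Sum>c\<in>PiE I A. \<Prod>i\<in>I. c i powi ?l e i * w i (c i)))"
    by (subst sum.swap) (simp add: sum_distrib_left)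
  also have "\<dots> = (\<Sum>e\<in>?K. ?l f e * (\<Prod>i\<in>I. \<Sum>u\<in>A i. u powi ?l e i * w i u))"
    using assms(1) A by (subst prod_sum_PiE) auto
  also have "\<dots> = (\<Sum>e\<in>?K. if e = 0 then ?l f e else 0)"
  proof (rule sum.cong[OF refl])
    fix e assume e: "e \<in> ?K"
    have supp: "Poly_Mapping.keys e \<subseteq> I" and deg: "(\<Sum>i\<in>I. ?l e i) = 0"
      and low: "\<And>i. i \<in> I \<Longrightarrow> - int (d i) \<le> ?l e i"
      using assms(2) e unfolding deg0_bounded_below_def by auto
    \<comment> \<open>Coordinates with positive exponent can stay unevaluated, since one negative
      entry already annihilates the whole product.\<close>
    have node: "(\<Sum>u\<in>A i. u powi ?l e i * w i u) = (if ?l e i = 0 then 1 else 0)"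
      if i: "i \<in> I" and nonpos: "?l e i \<le> 0" for i
    proof -
      obtain k where k: "?l e i = - int k" using nonpos by (metis nonpos_int_cases)
      then have "k < card (A i)" using low[OF i] A[OF i] by auto
      then show ?thesis
        using weighted_node_power_sum[of "A i" k] A[OF i] k by (simp add: w_def)
    qed
    show "?l f e * (\<Prod>i\<in>I. \<Sum>u\<in>A i. u powi ?l e i * w i u) = (if e = 0 then ?l f e else 0)"
    proof (cases "e = 0")
      case True
      then have "(\<Prod>i\<in>I. \<Sum>u\<in>A i. u powi ?l e i * w i u) = 1"
        using node by (intro prod.neutral) auto
      then show ?thesis using True by simp
    next
      case False
      have "\<exists>i\<in>I. ?l e i < 0"
      proof (rule ccontr)
        assume "\<not> ?thesis"
        then have "\<forall>i\<in>I. ?l e i = 0"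
          using deg assms(1) by (subst sum_nonneg_eq_0_iff[symmetric]) (auto simp: not_less)
        then have "e = 0"
          using supp by (intro poly_mapping_eqI) (auto simp: in_keys_iff subset_iff)
        then show False using False by simp
      qed
      then have "(\<Prod>i\<in>I. \<Sum>u\<in>A i. u powi ?l e i * w i u) = 0"
        using node assms(1) by (force intro!: prod_zero)
      then show ?thesis using False by simp
    qed
  qed
  also have "\<dots> = ?l f 0"
    by (simp add: in_keys_iff)
  finally show ?thesis by (simp add: w_def)
qed

lemma deg0_bounded_below_mult:
  assumes "deg0_bounded_below I d f" "deg0_bounded_below I d' g"
  shows "deg0_bounded_below I (\<lambda>i. d i + d' i) (f * g)"
  unfolding deg0_bounded_below_def
proof
  fix e assume "e \<in> Poly_Mapping.keys (f * g)"
  then obtain u v where e: "e = u + v" and u: "u \<in> Poly_Mapping.keys f" and v: "v \<in> Poly_Mapping.keys g"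
    using Poly_Mapping.keys_mult[of f g] by auto
  show "Poly_Mapping.keys e \<subseteq> I \<and> (\<Sum>i\<in>I. Poly_Mapping.lookup e i) = 0 \<and>
     (\<forall>i\<in>I. - int (d i + d' i) \<le> Poly_Mapping.lookup e i)"
    using assms u v Poly_Mapping.keys_add[of u v]
    unfolding deg0_bounded_below_def e by (fastforce simp: lookup_add sum.distrib)
qed

lemma deg0_bounded_below_prod:
  fixes f :: "'a \<Rightarrow> ('v \<Rightarrow>\<^sub>0 int) \<Rightarrow>\<^sub>0 'k::comm_ring_1"
  assumes "\<And>k. k \<in> K \<Longrightarrow> deg0_bounded_below I (d k) (f k)"
  shows "deg0_bounded_below I (\<lambda>i. \<Sum>k\<in>K. d k i) (prod f K)"
  using assms
  by (induction K rule: infinite_finite_induct)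
     (auto intro: deg0_bounded_below_mult simp: deg0_bounded_below_def[of _ _ 1])

lemma deg0_bounded_below_cong:
  assumes "deg0_bounded_below I d f" "\<And>i. i \<in> I \<Longrightarrow> d i = d' i"
  shows "deg0_bounded_below I d' f"
  using assms by (simp add: deg0_bounded_below_def)

subsection \<open>Uniqueness of the surviving grid point\<close>

text \<open>The steps add up along the chain of indices sorted by \<open>key\<close>. The extra unit
  for a descent is kept when the chain is split at \<open>i\<close>: if \<open>l < k\<close>, then
  \<open>i < k\<close> or \<open>l < i\<close>.\<close>

lemma chain_gap_lower_bound:
  fixes \<beta> b key :: "nat \<Rightarrow> nat"
  assumes "finite I" and inj: "inj_on key I"
    and step: "\<And>k l. k \<in> I \<Longrightarrow> l \<in> I \<Longrightarrow> key k < key l \<Longrightarrow> \<beta> k + b k + of_bool (l < k) \<le> \<beta> l"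
    and "k \<in> I" "l \<in> I" "key k < key l"
  shows "\<beta> k + (\<Sum>i | i \<in> I \<and> key k \<le> key i \<and> key i < key l. b i) + of_bool (l < k) \<le> \<beta> l"
  using assms(4-)
proof (induction "key l - key k" arbitrary: k l rule: less_induct)
  case less
  show ?case
  proof (cases "\<exists>i\<in>I. key k < key i \<and> key i < key l")
    case True
    then obtain i where i: "i \<in> I" "key k < key i" "key i < key l" by auto
    have split: "{j \<in> I. key k \<le> key j \<and> key j < key l}
        = {j \<in> I. key k \<le> key j \<and> key j < key i} \<union> {j \<in> I. key i \<le> key j \<and> key j < key l}"
      using i by auto
    have "(\<Sum>j | j \<in> I \<and> key k \<le> key j \<and> key j < key l. b j)
        = (\<Sum>j | j \<in> I \<and> key k \<le> key j \<and> key j < key i. b j)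
        + (\<Sum>j | j \<in> I \<and> key i \<le> key j \<and> key j < key l. b j)"
      unfolding split using assms(1) by (intro sum.union_disjoint) auto
    moreover have "\<beta> k + (\<Sum>j | j \<in> I \<and> key k \<le> key j \<and> key j < key i. b j) + of_bool (i < k) \<le> \<beta> i"
      using i less.prems by (intro less.hyps) auto
    moreover have "\<beta> i + (\<Sum>j | j \<in> I \<and> key i \<le> key j \<and> key j < key l. b j) + of_bool (l < i) \<le> \<beta> l"
      using i less.prems by (intro less.hyps) auto
    moreover have "of_bool (l < k) \<le> (of_bool (i < k) + of_bool (l < i) :: nat)" by auto
    ultimately show ?thesis by linarith
  next
    case False
    have "i = k" if "i \<in> I" "key k \<le> key i" "key i < key l" for i
      using False that less.prems(1) inj_onD[OF inj, of i k] by (metis le_neq_implies_less)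
    then have "{i \<in> I. key k \<le> key i \<and> key i < key l} = {k}"
      using less.prems by auto
    then show ?thesis using step less.prems by simp
  qed
qed

text \<open>The hypothesis \<open>nonvanishing\<close> says that \<open>\<beta> l\<close> avoids the
  interval of exponents at which a factor of the pair \<open>k\<close>, \<open>l\<close> is zero;
  \<open>upper\<close> is the range of the grid. Along the sorted order the gaps force
  \<open>\<beta>\<close> to be at least the partial sums of \<open>b\<close>, while the range leaves
  a slack of at most one. Every descent in the order costs a unit, so the order must be the natural
  one and the bounds coincide.\<close>

lemma unique_surviving_exponents:
  fixes \<beta> b :: "nat \<Rightarrow> nat"
  assumes "m < n"
    and upper: "\<And>k. k \<in> {1..n} \<Longrightarrow> \<beta> k + b k \<le> (\<Sum>i=1..n. b i) + of_bool (k \<le> m)"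
    and nonvanishing: "\<And>k l. k \<in> {1..n} \<Longrightarrow> l \<in> {1..n} \<Longrightarrow> k \<noteq> l \<Longrightarrow> \<beta> k + of_bool (l < k) \<le> \<beta> l \<Longrightarrow>
       \<beta> k + of_bool (l < k) + b k + of_bool (k = n \<and> l \<le> m) \<le> \<beta> l"
    and "l \<in> {1..n}"
  shows "\<beta> l = (\<Sum>i=1..<l. b i)"
proof -
  define I where "I = {1..n}"
  \<comment> \<open>encodes the lexicographic order of the pairs \<open>(\<beta> k, k)\<close>\<close>
  define key where "key k = \<beta> k * (n + 1) + k" for k
  have fin: "finite I" by (simp add: I_def)
  have lex: "key k < key l \<longleftrightarrow> \<beta> k < \<beta> l \<or> \<beta> k = \<beta> l \<and> k < l" if "k \<in> I" "l \<in> I" for k l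
  proof -
    have *: "key k < key l" if "\<beta> k < \<beta> l" "k \<in> I" for k l
    proof -
      have "Suc (\<beta> k) * (n + 1) \<le> \<beta> l * (n + 1)" using that by (intro mult_le_mono1) simp
      moreover have "k < n + 1" using that by (simp add: I_def)
      ultimately show ?thesis by (simp add: key_def)
    qed
    show ?thesis
    proof (cases "\<beta> k = \<beta> l")
      case False
      then show ?thesis using *[of k l] *[of l k] that by linarith
    qed (simp add: key_def)
  qed
  have inj: "inj_on key I"
  proof (rule inj_onI)
    fix k l assume "k \<in> I" "l \<in> I" "key k = key l"
    then show "k = l" using lex[of k l] lex[of l k] by auto
  qed
  have strict: "key k < key l" if "k \<in> I" "l \<in> I" "k \<noteq> l" "key k \<le> key l" for k l
    using that inj_onD[OF inj] by (meson le_neq_implies_less)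
  have order: "\<beta> k + of_bool (l < k) \<le> \<beta> l \<and> k \<noteq> l" if "k \<in> I" "l \<in> I" "key k < key l" for k l
    using that lex[of k l] by auto
  have step': "\<beta> k + of_bool (l < k) + b k + of_bool (k = n \<and> l \<le> m) \<le> \<beta> l"
    if "k \<in> I" "l \<in> I" "key k < key l" for k l
    using nonvanishing[of k l] order[OF that] that by (auto simp: I_def)
  \<comment> \<open>Partial sums along the sorted order: \<open>S k l\<close> from \<open>k\<close>
    up to but excluding \<open>l\<close>, and \<open>P l\<close> over everything before
    \<open>l\<close>.\<close>
  define S where "S k l = (\<Sum>i | i \<in> I \<and> key k \<le> key i \<and> key i < key l. b i)" for k l
  define P where "P l = (\<Sum>i | i \<in> I \<and> key i < key l. b i)" for l
  have gap: "\<beta> k + S k l + of_bool (l < k) \<le> \<beta> l" if "k \<in> I" "l \<in> I" "key k < key l" for k l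
    unfolding S_def
  proof (rule chain_gap_lower_bound[OF fin inj _ that])
    fix k l assume "k \<in> I" "l \<in> I" "key k < key l"
    from step'[OF this] show "\<beta> k + b k + of_bool (l < k) \<le> \<beta> l" by linarith
  qed
  have gap': "\<beta> k + S k l \<le> \<beta> l" if "k \<in> I" "l \<in> I" "key k \<le> key l" for k l
  proof (cases "k = l")
    case True
    then have "S k l = 0" unfolding S_def by (intro sum.neutral) auto
    then show ?thesis using True by simp
  next
    case False
    then have "key k < key l" using that strict by blast
    from gap[OF that(1,2) this] show ?thesis by linarith
  qed
  have PS: "P l = P k + S k l" if "k \<in> I" "l \<in> I" "key k \<le> key l" for k l
  proof -
    have split: "{i \<in> I. key i < key l} = {i \<in> I. key i < key k} \<union> {i \<in> I. key k \<le> key i \<and> key i < key l}"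
      using that by auto
    show ?thesis unfolding P_def S_def split using fin by (intro sum.union_disjoint) auto
  qed
  have ne: "I \<noteq> {}" using assms(1) by (auto simp: I_def)
  \<comment> \<open>The first index \<open>f\<close> yields the lower bounds on
    \<open>\<beta>\<close>; the last index \<open>t\<close>, chosen below, transports the upper end
    of the grid back to all other indices.\<close>
  obtain f where f: "f \<in> I" "\<And>i. i \<in> I \<Longrightarrow> key f \<le> key i"
    using fin ne arg_min_if_finite(1)[OF fin ne, of key] arg_min_least[OF fin ne, of _ key] by blast
  have P0: "P f = 0" unfolding P_def using f(2) by (intro sum.neutral) (auto simp: not_less[symmetric])
  have low: "P l \<le> \<beta> l" if "l \<in> I" for l
    using gap'[OF f(1) that f(2)[OF that]] PS[OF f(1) that f(2)[OF that]] P0 by linarith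
  obtain t where t: "t \<in> I" "\<And>i. i \<in> I \<Longrightarrow> key i \<le> key t"
  proof -
    have "Max (key ` I) \<in> key ` I" using fin ne by (intro Max_in) auto
    then obtain t where "t \<in> I" "key t = Max (key ` I)" by auto
    moreover have "key i \<le> Max (key ` I)" if "i \<in> I" for i using fin that by (intro Max_ge) auto
    ultimately show thesis by (intro that) auto
  qed
  have Pt: "P t + b t = (\<Sum>i\<in>I. b i)"
  proof -
    have "{i \<in> I. key i < key t} = I - {t}"
      using t strict by fastforce
    then show ?thesis unfolding P_def using fin t(1) by (simp add: sum.remove[of I t] add.commute)
  qed
  have up: "\<beta> t \<le> P t + of_bool (t \<le> m)"
    using upper[of t] t(1) Pt by (simp add: I_def)
  \<comment> \<open>The slack of one would be available only for \<open>t \<le> m\<close>. Then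
    \<open>n\<close> precedes \<open>t\<close>; let \<open>p\<close> be its immediate successor. If
    \<open>p \<le> m\<close>, the step from \<open>n\<close> to \<open>p\<close> gains one unit as a
    descent and one from the longer interval. Otherwise \<open>n > p > t\<close>, and the two
    descents gain a unit each. Both cases exceed the slack.\<close>
  have tm: "\<not> t \<le> m"
  proof
    assume tm: "t \<le> m"
    have nI: "n \<in> I" using assms(1) by (simp add: I_def)
    have "t \<noteq> n" using tm assms(1) by simp
    then have nt: "key n < key t"
      using t nI strict by blast
    define J where "J = {i \<in> I. key n < key i}"
    have J: "finite J" "J \<noteq> {}" using fin nt t(1) by (auto simp: J_def)
    obtain p where p: "p \<in> J" "\<And>i. i \<in> J \<Longrightarrow> key p \<le> key i"
      using arg_min_if_finite(1)[OF J, of key] arg_min_least[OF J, of _ key] by blast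
    have pI: "p \<in> I" and np: "key n < key p" using p(1) by (auto simp: J_def)
    have pt: "key p \<le> key t" using t(2)[OF pI] .
    have pn: "p < n" using pI np by (cases "p = n") (auto simp: I_def)
    have "{i \<in> I. key n \<le> key i \<and> key i < key p} = {n}"
    proof -
      have "i = n" if "i \<in> I" "key n \<le> key i" "key i < key p" for i
        using p(2)[of i] that strict[of n i] nI unfolding J_def by fastforce
      then show ?thesis using nI np by auto
    qed
    then have Snp: "S n p = b n" by (simp add: S_def)
    have eq: "P t = P n + S n p + S p t"
      using PS[OF nI pI] PS[OF pI t(1) pt] np by linarith
    show False
    proof (cases "p \<le> m")
      case True
      then have "\<beta> n + b n + 2 \<le> \<beta> p" using step'[OF nI pI np] pn by simp
      then show False using gap'[OF pI t(1) pt] low[OF nI] up eq Snp tm by simp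
    next
      case False
      then have "t < p" using tm by simp
      moreover have "key p < key t" using \<open>t < p\<close> pt pI t(1) by (intro strict) auto
      ultimately show False
        using gap[OF pI t(1)] gap[OF nI pI np] pn low[OF nI] up eq tm by simp
    qed
  qed
  \<comment> \<open>With the slack gone, a single descent already pushes \<open>\<beta> t\<close>
    beyond \<open>P t\<close>.\<close>
  have mono: "k < l" if "k \<in> I" "l \<in> I" "key k < key l" for k l
  proof (rule ccontr)
    assume "\<not> k < l"
    then have "l < k" using order[OF that] by simp
    then show False
      using gap[OF that] gap'[OF that(2) t(1) t(2)[OF that(2)]] PS[OF that(2) t(1) t(2)[OF that(2)]]
        PS[OF that(1,2)] that(3) low[OF that(1)] up tm by simp
  qed
  have l: "l \<in> I" using assms by (simp add: I_def)
  have "key i < key l \<longleftrightarrow> i < l" if "i \<in> I" for i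
    using mono[of i l] mono[of l i] that l inj by (metis inj_onD linorder_neq_iff order_less_asym)
  then have "{i \<in> I. key i < key l} = {1..<l}" using l by (auto simp: I_def)
  then have "P l = (\<Sum>i=1..<l. b i)" by (simp add: P_def)
  moreover have "\<beta> l \<le> P l"
    using gap'[OF l t(1) t(2)[OF l]] PS[OF l t(1) t(2)[OF l]] up tm by simp
  ultimately show ?thesis using low[OF l] by simp
qed

subsection \<open>The value at the surviving grid point\<close>

lemma prod_block_tiling:
  fixes b :: "nat \<Rightarrow> nat" and g :: "nat \<Rightarrow> 'a::comm_monoid_mult"
  assumes "1 \<le> p" "p \<le> r"
  shows "(\<Prod>k=p..<r. \<Prod>t<b k. g (t + (\<Sum>i=1..<k. b i))) = prod g {(\<Sum>i=1..<p. b i)..<(\<Sum>i=1..<r. b i)}"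
  using assms(2)
proof (induction r rule: dec_induct)
  case (step r)
  have "(\<Prod>t<b r. g (t + (\<Sum>i=1..<r. b i))) = prod g {(\<Sum>i=1..<r. b i)..<(\<Sum>i=1..<r. b i) + b r}"
    using prod.shift_bounds_nat_ivl[of g 0 "\<Sum>i=1..<r. b i" "b r"] by (simp add: add.commute atLeast0LessThan)
  moreover have "(\<Sum>i=1..<p. b i) \<le> (\<Sum>i=1..<r. b i)"
    using step.hyps by (intro sum_mono2) auto
  ultimately show ?case
    using step assms(1) by (simp add: prod.atLeastLessThan_concat)
qed simp

lemma prod_one_minus_quotient:
  fixes q :: "'k::field"
  assumes "q \<noteq> 0" "x \<le> y"
  shows "(\<Prod>t=x..<y. 1 - q ^ Suc t / q ^ x) = qpoch q q (y - x)"
proof -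
  have "(\<Prod>t=x..<y. 1 - q ^ Suc t / q ^ x) = (\<Prod>t<y - x. 1 - q ^ Suc (t + x) / q ^ x)"
    using prod.shift_bounds_nat_ivl[of "\<lambda>t. 1 - q ^ Suc t / q ^ x" 0 x "y - x"] assms(2)
    by (simp add: atLeast0LessThan)
  also have "\<dots> = qpoch q q (y - x)"
    unfolding qpoch_def using assms(1) by (intro prod.cong) (auto simp: power_add)
  finally show ?thesis .
qed

lemma qpoch_q_nonzero:
  fixes q :: "'k::field"
  assumes "\<And>j. j > 0 \<Longrightarrow> q ^ j \<noteq> 1"
  shows "qpoch q q k \<noteq> 0"
  using assms[of "Suc _"] by (auto simp: qpoch_def)

text \<open>
  The factors with \<open>k < l\<close> run over \<open>1 - q^u / q^(s l)\<close> for \<open>u < s l\<close>, because the blocks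
  \<open>[s k, s k + b k)\<close> tile \<open>[0, s l)\<close>. They cancel the nodes below \<open>q^(s l)\<close> in the weight.
\<close>

lemma surviving_term_factor:
  fixes q :: "'k::field" and b s :: "nat \<Rightarrow> nat"
  assumes q: "q \<noteq> 0" "\<And>j. j > 0 \<Longrightarrow> q ^ j \<noteq> 1"
    and "m < n" and l: "l \<in> {1..n}"
    and s: "\<And>k. s k = (\<Sum>i=1..<k. b i)"
  shows "(\<Prod>k\<in>{1..n} - {l}. \<Prod>t<b k + of_bool (k = n \<and> l \<le> m). 1 - q ^ (of_bool (l < k) + t + s k) / q ^ s l)
       * (\<Prod>t\<in>{..s (Suc n) - b l + of_bool (l \<le> m)} - {s l}. 1 / (1 - q ^ t / q ^ s l))
     = qpoch q q (s (Suc n) - s l + of_bool (l \<le> m))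
       / (qpoch q q (b l) * qpoch q q (s (Suc n) - s (Suc l) + of_bool (l \<le> m)))"
proof -
  define \<chi> where "\<chi> = (of_bool (l \<le> m) :: nat)"
  define g where "g u = 1 - q ^ u / q ^ s l" for u
  define S where "S = s (Suc n)"
  define d where "d = S - b l + \<chi>"
  have s_Suc: "s (Suc k) = s k + b k" if "1 \<le> k" for k using that by (simp add: s)
  have s_mono: "s k \<le> s k'" if "k \<le> k'" for k k' unfolding s using that by (intro sum_mono2) auto
  have le: "s l + b l \<le> S" using s_mono[of "Suc l" "Suc n"] s_Suc[of l] l by (simp add: S_def)
  have low: "(\<Prod>k=1..<l. \<Prod>t<b k + of_bool (k = n \<and> l \<le> m). 1 - q ^ (of_bool (l < k) + t + s k) / q ^ s l)
      = prod g {..<s l}"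
  proof -
    have "(\<Prod>k=1..<l. \<Prod>t<b k + of_bool (k = n \<and> l \<le> m). 1 - q ^ (of_bool (l < k) + t + s k) / q ^ s l)
      = (\<Prod>k=1..<l. \<Prod>t<b k. g (t + s k))"
      using l by (intro prod.cong) (auto simp: g_def)
    also have "\<dots> = prod g {..<s l}"
      using prod_block_tiling[of 1 l g b] l by (simp add: s atLeast0LessThan)
    finally show ?thesis .
  qed
  \<comment> \<open>For \<open>k > l\<close> all exponents are shifted up by one, and the possible
    extra factor at \<open>k = n\<close> lengthens the last block by \<open>\<chi>\<close>. For
    \<open>l = n\<close> the range is empty and \<open>\<chi> = 0\<close>, because
    \<open>m < n\<close>.\<close>
  have high: "(\<Prod>k\<in>{l<..n}. \<Prod>t<b k + of_bool (k = n \<and> l \<le> m). 1 - q ^ (of_bool (l < k) + t + s k) / q ^ s l)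
      = (\<Prod>u=s (Suc l)..<S + \<chi>. g (Suc u))"
  proof (cases "l = n")
    case True
    then show ?thesis using assms(3) by (simp add: S_def \<chi>_def)
  next
    case False
    then have ln: "l < n" using l by simp
    have set: "{l<..n} = insert n {Suc l..<n}" using ln by auto
    have "(\<Prod>k\<in>{l<..n}. \<Prod>t<b k + of_bool (k = n \<and> l \<le> m). 1 - q ^ (of_bool (l < k) + t + s k) / q ^ s l)
      = (\<Prod>t<b n + \<chi>. g (Suc (t + s n))) * (\<Prod>k=Suc l..<n. \<Prod>t<b k. g (Suc (t + s k)))"
      unfolding set using ln by (simp add: g_def \<chi>_def)
    also have "(\<Prod>k=Suc l..<n. \<Prod>t<b k. g (Suc (t + s k))) = (\<Prod>u=s (Suc l)..<s n. g (Suc u))"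
      using prod_block_tiling[of "Suc l" n "\<lambda>u. g (Suc u)" b] ln by (simp add: s)
    also have "(\<Prod>t<b n + \<chi>. g (Suc (t + s n))) = (\<Prod>u=s n..<S + \<chi>. g (Suc u))"
      using prod.shift_bounds_nat_ivl[of "\<lambda>u. g (Suc u)" 0 "s n" "b n + \<chi>"] s_Suc[of n] ln
      by (simp add: S_def atLeast0LessThan add_ac)
    also have "(\<Prod>u=s n..<S + \<chi>. g (Suc u)) * (\<Prod>u=s (Suc l)..<s n. g (Suc u))
        = (\<Prod>u=s (Suc l)..<S + \<chi>. g (Suc u))"
      using s_mono[of "Suc l" n] s_mono[of n "Suc n"] ln
      by (subst mult.commute) (simp add: prod.atLeastLessThan_concat S_def)
    finally show ?thesis .
  qed
  have "{1..n} - {l} = {1..<l} \<union> {l<..n}" "{1..<l} \<inter> {l<..n} = {}" using l by auto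
  then have lhs1: "(\<Prod>k\<in>{1..n} - {l}. \<Prod>t<b k + of_bool (k = n \<and> l \<le> m). 1 - q ^ (of_bool (l < k) + t + s k) / q ^ s l)
     = prod g {..<s l} * (\<Prod>u=s (Suc l)..<S + \<chi>. g (Suc u))"
    unfolding low[symmetric] high[symmetric] by (simp only: prod.union_disjoint finite_atLeastLessThan finite_greaterThanAtMost)
  \<comment> \<open>The nodes below \<open>q ^ s l\<close> give the factors to be cancelled; those
    above it form a q-Pochhammer symbol.\<close>
  have "{..d} - {s l} = {..<s l} \<union> {Suc (s l)..<Suc d}" using le by (auto simp: d_def)
  moreover have "{..<s l} \<inter> {Suc (s l)..<Suc d} = {}" by auto
  ultimately have "prod g ({..d} - {s l}) = prod g {..<s l} * prod g {Suc (s l)..<Suc d}"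
    by (simp add: prod.union_disjoint)
  also have "prod g {Suc (s l)..<Suc d} = (\<Prod>t=s l..<d. g (Suc t))"
    by (rule prod.shift_bounds_Suc_ivl)
  also have "\<dots> = qpoch q q (S - s (Suc l) + \<chi>)"
    using prod_one_minus_quotient[of q "s l" d] q le l s_Suc[of l]
    by (simp add: g_def d_def add.commute)
  finally have lhs2: "prod g ({..d} - {s l}) = prod g {..<s l} * qpoch q q (S - s (Suc l) + \<chi>)" .
  \<comment> \<open>The factors with \<open>k > l\<close> miss exactly the block of \<open>l\<close>
    itself, which would contribute \<open>qpoch q q (b l)\<close>.\<close>
  have up: "qpoch q q (b l) * (\<Prod>u=s (Suc l)..<S + \<chi>. g (Suc u)) = qpoch q q (S - s l + \<chi>)"
  proof -
    have "qpoch q q (b l) = (\<Prod>u=s l..<s (Suc l). g (Suc u))"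
      using prod_one_minus_quotient[of q "s l" "s (Suc l)"] q s_Suc[of l] l by (simp add: g_def)
    moreover have "qpoch q q (S - s l + \<chi>) = (\<Prod>u=s l..<S + \<chi>. g (Suc u))"
      using prod_one_minus_quotient[of q "s l" "S + \<chi>"] q le by (simp add: g_def)
    ultimately show ?thesis
      using s_Suc[of l] l le by (simp add: prod.atLeastLessThan_concat)
  qed
  have "g u \<noteq> 0" if "u < s l" for u
  proof
    assume "g u = 0"
    then have "q ^ u = q ^ s l" using q(1) by (simp add: g_def)
    also have "\<dots> = q ^ (s l - u) * q ^ u" using that by (simp flip: power_add)
    finally have "q ^ u = q ^ (s l - u) * q ^ u" .
    then show False using q(1) q(2)[of "s l - u"] that by simp
  qed
  then have nz: "prod g {..<s l} \<noteq> 0" by simp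
  have nz': "qpoch q q (b l) \<noteq> 0" by (rule qpoch_q_nonzero[OF q(2)])
  have w: "(\<Prod>t\<in>{..d} - {s l}. 1 / (1 - q ^ t / q ^ s l)) = 1 / prod g ({..d} - {s l})"
    by (simp add: g_def prod_dividef)
  show ?thesis
    unfolding lhs1 S_def[symmetric] \<chi>_def[symmetric] d_def[symmetric] w lhs2 up[symmetric]
    using nz nz' by simp
qed

lemma prod_quotient_telescope:
  fixes f :: "nat \<Rightarrow> 'k::field"
  assumes "\<And>i. f i \<noteq> 0" "p \<le> r"
  shows "(\<Prod>i=p..<r. f i / f (Suc i)) = f p / f r"
  using assms(2) by (induction r rule: dec_induct) (auto simp: assms(1))

text \<open>The factors from the preceding lemma telescope separately over \<open>l \<le> m\<close>,
  where the Pochhammer lengths carry an extra 1, and over \<open>l > m\<close>, where they do not.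
  The mismatch at the two ends of the first range produces the fraction in front of the multinomial
  coefficient.\<close>

lemma surviving_term_value:
  fixes q :: "'k::field" and b s :: "nat \<Rightarrow> nat"
  assumes q: "q \<noteq> 0" "\<And>j. j > 0 \<Longrightarrow> q ^ j \<noteq> 1"
    and "m < n"
    and s: "\<And>k. s k = (\<Sum>i=1..<k. b i)"
  shows "(\<Prod>l\<in>{1..n}. \<Prod>k\<in>{1..n} - {l}. \<Prod>t<b k + of_bool (k = n \<and> l \<le> m). 1 - q ^ (of_bool (l < k) + t + s k) / q ^ s l)
       * (\<Prod>l\<in>{1..n}. \<Prod>t\<in>{..s (Suc n) - b l + of_bool (l \<le> m)} - {s l}. 1 / (1 - q ^ t / q ^ s l))
     = (1 - q ^ (1 + s (Suc n))) / (1 - q ^ (1 + (\<Sum>v=Suc m..n. b v)))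
       * (qpoch q q (s (Suc n)) / (\<Prod>l=1..n. qpoch q q (b l)))"
    (is "?L = _")
proof -
  define S where "S = s (Suc n)"
  define W where "W e l = qpoch q q (S - s l + e)" for e l
  have W: "W e l \<noteq> 0" for e l unfolding W_def by (rule qpoch_q_nonzero[OF q(2)])
  have "?L = (\<Prod>l=1..n. W (of_bool (l \<le> m)) l / (qpoch q q (b l) * W (of_bool (l \<le> m)) (Suc l)))"
    unfolding W_def S_def prod.distrib[symmetric]
    by (rule prod.cong[OF refl], rule surviving_term_factor[OF q assms(3) _ s])
  also have "\<dots> = (\<Prod>l=1..n. W (of_bool (l \<le> m)) l / W (of_bool (l \<le> m)) (Suc l)) / (\<Prod>l=1..n. qpoch q q (b l))"
    by (simp add: prod_dividef prod.distrib mult.commute)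
  also have "(\<Prod>l=1..n. W (of_bool (l \<le> m)) l / W (of_bool (l \<le> m)) (Suc l))
      = (\<Prod>l=1..<Suc m. W 1 l / W 1 (Suc l)) * (\<Prod>l=Suc m..<Suc n. W 0 l / W 0 (Suc l))"
  proof -
    have "{1..n} = {1..<Suc m} \<union> {Suc m..<Suc n}" using assms(3) by auto
    then have "(\<Prod>l=1..n. W (of_bool (l \<le> m)) l / W (of_bool (l \<le> m)) (Suc l))
      = (\<Prod>l=1..<Suc m. W (of_bool (l \<le> m)) l / W (of_bool (l \<le> m)) (Suc l))
       * (\<Prod>l=Suc m..<Suc n. W (of_bool (l \<le> m)) l / W (of_bool (l \<le> m)) (Suc l))"
      by (simp only:) (rule prod.union_disjoint; auto)
    also have "\<dots> = (\<Prod>l=1..<Suc m. W 1 l / W 1 (Suc l)) * (\<Prod>l=Suc m..<Suc n. W 0 l / W 0 (Suc l))"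
      by (intro arg_cong2[where f = "(*)"] prod.cong) auto
    finally show ?thesis .
  qed
  also have "\<dots> = (W 1 1 / W 1 (Suc m)) * (W 0 (Suc m) / W 0 (Suc n))"
    using assms(3) by (subst (1 2) prod_quotient_telescope) (auto simp: W)
  also have "\<dots> = (1 - q ^ (1 + S)) / (1 - q ^ (1 + (\<Sum>v=Suc m..n. b v))) * qpoch q q S"
  proof -
    \<comment> \<open>The last Pochhammer factor is taken at \<open>l = 1\<close> for the numerator
      and at \<open>l = Suc m\<close> for the denominator.\<close>
    have step: "W 1 l = W 0 l * (1 - q ^ (1 + (S - s l)))" for l
      by (simp add: W_def qpoch_def)
    have "S = s (Suc m) + (\<Sum>v=Suc m..n. b v)"
      using sum.atLeastLessThan_concat[of 1 "Suc m" "Suc n" b] assms(3)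
      by (simp add: S_def s atLeastLessThanSuc_atLeastAtMost)
    then have "S - s (Suc m) = (\<Sum>v=Suc m..n. b v)" by simp
    moreover have "W 0 1 = qpoch q q S" by (simp add: W_def s)
    moreover have "W 0 (Suc n) = 1" by (simp add: W_def S_def qpoch_def)
    moreover have "s 1 = 0" by (simp add: s)
    ultimately show ?thesis using step[of 1] step[of "Suc m"] W[of 0 "Suc m"] by simp
  qed
  finally show ?thesis by (simp add: S_def)
qed

subsection \<open>Products over pairs of indeterminates\<close>

lemma q_ind_power: "q_ind ^ k = Fract (monom 1 k) 1"
proof (induction k)
  case (Suc k)
  have "[:0, 1:] = (monom 1 1 :: rat poly)" by (simp add: monom_altdef)
  then show ?case using Suc by (simp add: q_ind_def mult_monom)
qed (simp add: One_fract_def)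

lemma q_ind_nonzero: "q_ind \<noteq> 0"
  by (simp add: q_ind_def Zero_fract_def eq_fract)

text \<open>Degrees of monomials separate the powers. This makes the grid nodes distinct and lets a
  vanishing factor be read off from its exponents.\<close>

lemma q_ind_power_inject: "q_ind ^ i = q_ind ^ j \<longleftrightarrow> i = j"
proof
  assume "q_ind ^ i = q_ind ^ j"
  then have "monom 1 i = (monom 1 j :: rat poly)" by (simp add: q_ind_power eq_fract)
  then have "degree (monom 1 i :: rat poly) = degree (monom 1 j :: rat poly)" by (rule arg_cong)
  then show "i = j" by (simp add: degree_monom_eq)
qed simp

lemma q_ind_power_neq_1: "j > 0 \<Longrightarrow> q_ind ^ j \<noteq> 1"
  using q_ind_power_inject[of j 0] by simp

lemma const_laurent_power: "const_laurent u ^ k = const_laurent (u ^ k)"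
  by (induction k) (simp_all add: const_laurent_def mult_single)

text \<open>The exponent \<open>e\<close> treats both Pochhammer symbols of a pair alike: 0 for the
  one without the factor q and 1 for the one with it.\<close>

lemma qpoch_x_quot:
  "qpoch (const_laurent u) (const_laurent u ^ e * x_quot i j) k =
     (\<Prod>t<k. 1 - Poly_Mapping.single (Poly_Mapping.single i 1 - Poly_Mapping.single j 1) (u ^ (e + t)))"
  unfolding qpoch_def const_laurent_power
  by (simp add: const_laurent_def x_quot_def mult_single power_add)

lemma laurent_eval_x_quot:
  assumes "finite I" "i \<in> I" "j \<in> I" "i \<noteq> j"
  shows "laurent_eval I c (Poly_Mapping.single (Poly_Mapping.single i 1 - Poly_Mapping.single j 1) u)
    = u * (c i / c j)"
proof -
  have "(\<Prod>k\<in>I. c k powi Poly_Mapping.lookup (Poly_Mapping.single i 1 - Poly_Mapping.single j 1) k)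
      = c i * inverse (c j) * (\<Prod>k\<in>I - {i} - {j}. 1)"
    using assms
    by (subst prod.remove[of I i], simp, simp, subst prod.remove[of "I - {i}" j])
       (auto simp: lookup_minus lookup_single when_def power_int_minus mult.assoc intro!: prod.neutral)
  then show ?thesis by (simp add: laurent_eval_single divide_inverse)
qed

lemma deg0_bounded_below_x_quot:
  fixes u :: "'k::comm_ring_1"
  assumes "finite I" "i \<in> I" "j \<in> I" "i \<noteq> j"
  shows "deg0_bounded_below I (\<lambda>k. of_bool (k = j))
    (1 - Poly_Mapping.single (Poly_Mapping.single i 1 - Poly_Mapping.single j 1) u)"
  unfolding deg0_bounded_below_def
proof
  let ?e = "Poly_Mapping.single i 1 - Poly_Mapping.single j 1 :: 'a \<Rightarrow>\<^sub>0 int"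
  fix e assume e: "e \<in> Poly_Mapping.keys (1 - Poly_Mapping.single ?e u)"
  have "e \<in> {0, ?e}"
    using e Poly_Mapping.keys_diff[of 1 "Poly_Mapping.single ?e u"] by (auto split: if_splits)
  moreover have "Poly_Mapping.keys ?e \<subseteq> I"
    using Poly_Mapping.keys_diff[of "Poly_Mapping.single i (1::int)" "Poly_Mapping.single j 1"] assms by auto
  moreover have "(\<Sum>k\<in>I. Poly_Mapping.lookup ?e k) = 0"
    using assms by (simp add: lookup_minus lookup_single when_def sum_subtractf)
  ultimately show "Poly_Mapping.keys e \<subseteq> I \<and> (\<Sum>k\<in>I. Poly_Mapping.lookup e k) = 0 \<and>
     (\<forall>k\<in>I. - int (of_bool (k = j)) \<le> Poly_Mapping.lookup e k)"
    by (auto simp: lookup_minus lookup_single when_def)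
qed

text \<open>Every pair of distinct indices occurs once in each orientation. The form over ordered
  pairs can be reindexed by any permutation.\<close>

lemma prod_pairs_below_diagonal:
  fixes F :: "nat \<Rightarrow> nat \<Rightarrow> 'a::comm_monoid_mult"
  shows "(\<Prod>j\<in>{1..n}. \<Prod>i\<in>{1..<j}. F i j * F j i) = (\<Prod>j\<in>{1..n}. \<Prod>i\<in>{1..n} - {j}. F i j)"
proof -
  have "(\<Prod>j\<in>{1..n}. \<Prod>i\<in>{1..<j}. F j i) = (\<Prod>j\<in>{1..n}. \<Prod>i\<in>{i \<in> {1..n}. i < j}. F j i)"
    by (intro prod.cong) auto
  also have "\<dots> = (\<Prod>i\<in>{1..n}. \<Prod>j\<in>{j \<in> {1..n}. i < j}. F j i)"
    by (rule prod.swap_restrict) auto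
  finally have "(\<Prod>j\<in>{1..n}. \<Prod>i\<in>{1..<j}. F i j * F j i)
      = (\<Prod>j\<in>{1..n}. (\<Prod>i\<in>{1..<j}. F i j) * (\<Prod>i\<in>{i \<in> {1..n}. j < i}. F i j))"
    by (simp add: prod.distrib)
  also have "\<dots> = (\<Prod>j\<in>{1..n}. \<Prod>i\<in>{1..n} - {j}. F i j)"
  proof (rule prod.cong[OF refl])
    fix j assume "j \<in> {1..n}"
    then have "{1..n} - {j} = {1..<j} \<union> {i \<in> {1..n}. j < i}" by auto
    moreover have "{1..<j} \<inter> {i \<in> {1..n}. j < i} = {}" "finite {i \<in> {1..n}. j < i}" by auto
    ultimately show "(\<Prod>i\<in>{1..<j}. F i j) * (\<Prod>i\<in>{i \<in> {1..n}. j < i}. F i j) = (\<Prod>i\<in>{1..n} - {j}. F i j)"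
      by (simp only: prod.union_disjoint finite_atLeastLessThan)
  qed
  finally show ?thesis .
qed

text \<open>Each factor with \<open>x_i\<close> in the denominator raises the pole order in
  \<open>x_i\<close> by at most one, so this order is at most the sum of the \<open>K k i\<close>,
  and \<open>A i\<close> has enough nodes for the interpolation formula.\<close>

lemma CT_pair_product:
  fixes E K :: "nat \<Rightarrow> nat \<Rightarrow> nat" and A :: "nat \<Rightarrow> ratfun set"
  assumes "finite I"
    and A: "\<And>i. i \<in> I \<Longrightarrow> finite (A i) \<and> 0 \<notin> A i \<and> (\<Sum>k\<in>I - {i}. K k i) < card (A i)"
  shows "CT (\<Prod>j\<in>I. \<Prod>i\<in>I - {j}.
        qpoch (const_laurent q_ind) (const_laurent q_ind ^ E i j * x_quot i j) (K i j))
     = (\<Sum>c\<in>PiE I A. (\<Prod>j\<in>I. \<Prod>i\<in>I - {j}. \<Prod>t<K i j. 1 - q_ind ^ (E i j + t) * (c i / c j))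
          * (\<Prod>i\<in>I. \<Prod>z\<in>A i - {c i}. 1 / (1 - z / c i)))"
proof -
  let ?f = "\<Prod>j\<in>I. \<Prod>i\<in>I - {j}. \<Prod>t<K i j.
        1 - Poly_Mapping.single (Poly_Mapping.single i 1 - Poly_Mapping.single j 1) (q_ind ^ (E i j + t))"
  have "deg0_bounded_below I (\<lambda>k. \<Sum>j\<in>I. \<Sum>i\<in>I - {j}. \<Sum>t<K i j. of_bool (k = j)) ?f"
    using assms(1) by (intro deg0_bounded_below_prod deg0_bounded_below_x_quot) auto
  moreover have "(\<Sum>j\<in>I. \<Sum>i\<in>I - {j}. \<Sum>t<K i j. of_bool (k = j)) = (\<Sum>i\<in>I - {k}. K i k)"
    if "k \<in> I" for k
  proof -
    have "(\<Sum>j\<in>I. \<Sum>i\<in>I - {j}. \<Sum>t<K i j. of_bool (k = j))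
        = (\<Sum>j\<in>I. if k = j then \<Sum>i\<in>I - {j}. K i j else 0)"
      by (intro sum.cong) auto
    then show ?thesis using that assms(1) by simp
  qed
  ultimately have "deg0_bounded_below I (\<lambda>k. \<Sum>i\<in>I - {k}. K i k) ?f"
    by (rule deg0_bounded_below_cong)
  from lookup_0_eq_sum_laurent_eval[OF assms(1) this A]
  have "CT ?f = (\<Sum>c\<in>PiE I A. laurent_eval I c ?f * (\<Prod>i\<in>I. \<Prod>z\<in>A i - {c i}. 1 / (1 - z / c i)))"
    by (simp add: CT_def)
  also have "\<dots> = (\<Sum>c\<in>PiE I A. (\<Prod>j\<in>I. \<Prod>i\<in>I - {j}. \<Prod>t<K i j. 1 - q_ind ^ (E i j + t) * (c i / c j))
          * (\<Prod>i\<in>I. \<Prod>z\<in>A i - {c i}. 1 / (1 - z / c i)))"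
  proof (rule sum.cong[OF refl])
    fix c assume c: "c \<in> PiE I A"
    then have nz: "c i \<noteq> 0" if "i \<in> I" for i using A[OF that] that by (metis PiE_mem)
    have hom: "laurent_eval I c (prod F J) = (\<Prod>k\<in>J. laurent_eval I c (F k))" for F J
      by (rule laurent_eval_prod) (rule nz)
    have "laurent_eval I c ?f = (\<Prod>j\<in>I. \<Prod>i\<in>I - {j}. \<Prod>t<K i j. 1 - q_ind ^ (E i j + t) * (c i / c j))"
      unfolding hom using assms(1)
      by (intro prod.cong refl)
         (auto simp: laurent_eval_diff laurent_eval_one laurent_eval_x_quot)
    then show "laurent_eval I c ?f * (\<Prod>i\<in>I. \<Prod>z\<in>A i - {c i}. 1 / (1 - z / c i))
      = (\<Prod>j\<in>I. \<Prod>i\<in>I - {j}. \<Prod>t<K i j. 1 - q_ind ^ (E i j + t) * (c i / c j))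
          * (\<Prod>i\<in>I. \<Prod>z\<in>A i - {c i}. 1 / (1 - z / c i))" by simp
  qed
  finally show ?thesis by (simp add: qpoch_x_quot)
qed

subsection \<open>Cyclic rotation of the indices\<close>

lemma cyc_index_add:
  assumes "r \<in> {1..n}" "k \<in> {1..n}"
  shows "cyc_index n (r + k) = (if r + k \<le> n then r + k else r + k - n)"
proof (cases "r + k \<le> n")
  case True
  then show ?thesis using assms by (simp add: cyc_index_def)
next
  case False
  then have "(r + k - 1) mod n = r + k - 1 - n" using assms by (subst mod_if) (auto simp: mod_if)
  then show ?thesis using False assms by (simp add: cyc_index_def)
qed

lemma bij_betw_cyc_index:
  assumes "r \<in> {1..n}"
  shows "bij_betw (\<lambda>k. cyc_index n (r + k)) {1..n} {1..n}"
proof -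
  have "inj_on (\<lambda>k. cyc_index n (r + k)) {1..n}"
    using assms by (auto simp: inj_on_def cyc_index_add split: if_splits)
  moreover have "(\<lambda>k. cyc_index n (r + k)) ` {1..n} \<subseteq> {1..n}"
    using assms by (auto simp: cyc_index_add)
  ultimately show ?thesis
    by (simp add: bij_betw_def endo_inj_surj)
qed

text \<open>The indices at most \<open>r\<close> are those that wrap around. The rotation preserves
  the order unless exactly one of the two indices wraps, and then the offset of the first node makes
  up for the reversed comparison.\<close>

lemma cyc_index_order_shift:
  assumes "r \<in> {1..n}" "k \<in> {1..n}" "l \<in> {1..n}" "k \<noteq> l"
  shows "of_bool (cyc_index n (r + l) < cyc_index n (r + k)) + of_bool (cyc_index n (r + k) \<le> r)
       = of_bool (cyc_index n (r + l) \<le> r) + (of_bool (l < k) :: nat)"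
  using assms by (auto simp: cyc_index_add)

lemma prod_pairs_reindex:
  fixes G :: "'a \<Rightarrow> 'a \<Rightarrow> 'b::comm_monoid_mult"
  assumes "bij_betw \<sigma> I I"
  shows "(\<Prod>j\<in>I. \<Prod>i\<in>I - {j}. G i j) = (\<Prod>l\<in>I. \<Prod>k\<in>I - {l}. G (\<sigma> k) (\<sigma> l))"
proof -
  have "bij_betw \<sigma> (I - {l}) (I - {\<sigma> l})" if "l \<in> I" for l
    using assms that by (auto simp: bij_betw_def inj_on_def)
  then have "(\<Prod>k\<in>I - {l}. G (\<sigma> k) (\<sigma> l)) = (\<Prod>i\<in>I - {\<sigma> l}. G i (\<sigma> l))" if "l \<in> I" for l
    using that by (intro prod.reindex_bij_betw)
  then show ?thesis
    using prod.reindex_bij_betw[OF assms, of "\<lambda>j. \<Prod>i\<in>I - {j}. G i j"] by simp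
qed

section \<open>The grid in rotated indices and the evaluation of the constant term\<close>

theorem theorem6:
  fixes n m r :: nat and a :: "nat \<Rightarrow> nat" and M :: "nat set"
  assumes "n \<ge> 1" and "m < n" and "r \<in> {1..n}"
    and "M = cyc_block n r m"
  shows "CT (\<Prod>j\<in>{1..n}. \<Prod>i\<in>{1..<j}.
            qpoch (const_laurent q_ind) (x_quot i j) (astar a r M i j)
          * qpoch (const_laurent q_ind) (const_laurent q_ind * x_quot j i) (astar a r M j i))
       = (1 - q_ind ^ (1 + (\<Sum>v=1..n. a v))) / (1 - q_ind ^ (1 + (\<Sum>v\<in>{1..n} - M. a v)))
         * qmultinomial n a"
proof -
  define I where "I = {1..n}"
  define q where "q = q_ind"
  define \<sigma> where "\<sigma> k = cyc_index n (r + k)" for k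
  define b where "b k = a (\<sigma> k)" for k
  define s where "s k = (\<Sum>i=1..<k. b i)" for k
  define \<delta> where "\<delta> i = (of_bool (i \<le> r) :: nat)" for i
  define K where "K = astar a r M"
  \<comment> \<open>\<open>D i\<close> counts the factors with \<open>x_i\<close> in the
    denominator; \<open>A i\<close> has one node more.\<close>
  define D where "D i = (\<Sum>k\<in>I - {i}. K k i)" for i
  define A where "A i = (\<lambda>t. q ^ (t + \<delta> i)) ` {..D i}" for i
  have q: "q \<noteq> 0" "\<And>j. j > 0 \<Longrightarrow> q ^ j \<noteq> 1" "\<And>i j. q ^ i = q ^ j \<longleftrightarrow> i = j"
    by (simp_all add: q_def q_ind_nonzero q_ind_power_neq_1 q_ind_power_inject)
  have finI: "finite I" by (simp add: I_def)
  have bij: "bij_betw \<sigma> I I"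
    unfolding I_def \<sigma>_def by (rule bij_betw_cyc_index[OF assms(3)])
  have inj: "inj_on \<sigma> I" and img: "\<sigma> ` I = I" using bij by (auto simp: bij_betw_def)
  have \<sigma>I: "\<sigma> k \<in> I" if "k \<in> I" for k using img that by auto
  have nI: "n \<in> I" using assms(1) by (simp add: I_def)
  have \<sigma>n: "\<sigma> n = r" using assms cyc_index_add[of r n n] by (simp add: \<sigma>_def)
  have M: "M = \<sigma> ` {1..m}"
  proof -
    have "{r+1..r+m} = (+) r ` {1..m}" by (simp add: image_add_atLeastAtMost)
    moreover have "\<sigma> = (\<lambda>k. cyc_index n (r + k))" by (simp add: fun_eq_iff \<sigma>_def)
    ultimately show ?thesis by (simp only: assms(4) cyc_block_def image_image)
  qed
  have mI: "{1..m} \<subseteq> I" using assms(2) by (auto simp: I_def)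
  have inM: "\<sigma> l \<in> M \<longleftrightarrow> l \<le> m" if "l \<in> I" for l
    unfolding M inj_on_image_mem_iff[OF inj that mI] using that by (auto simp: I_def)
  have isr: "\<sigma> k = r \<longleftrightarrow> k = n" if "k \<in> I" for k
    using \<sigma>n inj_onD[OF inj _ that nI] by auto
  \<comment> \<open>Since \<open>\<sigma>\<close> maps \<open>n\<close> to \<open>r\<close> and
    \<open>{1..m}\<close> onto \<open>M\<close>, the extra unit of \<open>astar\<close> moves to
    \<open>k = n\<close>, \<open>l \<le> m\<close>.\<close>
  have K: "K (\<sigma> k) (\<sigma> l) = b k + of_bool (k = n \<and> l \<le> m)" if "k \<in> I" "l \<in> I" for k l
    using that inM isr by (auto simp: K_def astar_def b_def)
  have sn: "s (Suc n) = (\<Sum>i\<in>I. b i)"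
    by (simp add: s_def I_def atLeastLessThanSuc_atLeastAtMost)
  have sn': "s (Suc n) = (\<Sum>i\<in>I. a i)"
    unfolding sn b_def using sum.reindex_bij_betw[OF bij, of a] .
  have D: "D (\<sigma> l) = s (Suc n) - b l + of_bool (l \<le> m)" if l: "l \<in> I" for l
  proof -
    have "bij_betw \<sigma> (I - {l}) (I - {\<sigma> l})"
      using bij l by (auto simp: bij_betw_def inj_on_def)
    then have "D (\<sigma> l) = (\<Sum>k\<in>I - {l}. K (\<sigma> k) (\<sigma> l))"
      unfolding D_def by (rule sum.reindex_bij_betw[symmetric])
    also have "\<dots> = (\<Sum>k\<in>I - {l}. b k + of_bool (k = n \<and> l \<le> m))"
      using l by (intro sum.cong) (auto simp: K)
    also have "\<dots> = (\<Sum>k\<in>I - {l}. b k) + (\<Sum>k\<in>I - {l}. of_bool (k = n \<and> l \<le> m))"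
      by (rule sum.distrib)
    also have "(\<Sum>k\<in>I - {l}. of_bool (k = n \<and> l \<le> m)) = (of_bool (l \<le> m) :: nat)"
    proof (cases "l \<le> m")
      case True
      then have "n \<in> I - {l}" using nI assms(2) by auto
      then show ?thesis using True finI by (simp add: of_bool_def)
    qed simp
    also have "(\<Sum>k\<in>I - {l}. b k) = s (Suc n) - b l"
      unfolding sn using finI l by (simp add: sum_diff1_nat)
    finally show ?thesis .
  qed
  have bl: "s l + b l \<le> s (Suc n)" if "l \<in> I" for l
  proof -
    have "s l + b l = (\<Sum>i=1..<Suc l. b i)" using that by (simp add: s_def I_def)
    also have "\<dots> \<le> s (Suc n)" unfolding s_def using that by (intro sum_mono2) (auto simp: I_def)
    finally show ?thesis .
  qed
  have injA: "inj_on (\<lambda>t. q ^ (t + \<delta> i)) X" for i X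
    by (auto simp: inj_on_def q(3))

  define T where "T c = (\<Prod>j\<in>I. \<Prod>i\<in>I - {j}. \<Prod>t<K i j. 1 - q ^ (of_bool (j < i) + t) * (c i / c j))" for c
  define W where "W c = (\<Prod>i\<in>I. \<Prod>z\<in>A i - {c i}. 1 / (1 - z / c i))" for c
  \<comment> \<open>The node offsets \<open>\<delta>\<close> turn the comparison of the original
    indices into one of the rotated indices and then cancel from the quotient.\<close>
  have T: "T c = (\<Prod>l\<in>I. \<Prod>k\<in>I - {l}. \<Prod>t<b k + of_bool (k = n \<and> l \<le> m).
        1 - q ^ (of_bool (l < k) + t + \<beta> k) / q ^ \<beta> l)"
    if c: "\<And>k. k \<in> I \<Longrightarrow> c (\<sigma> k) = q ^ (\<beta> k + \<delta> (\<sigma> k))" for c \<beta>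
  proof -
    have "q ^ (of_bool (\<sigma> l < \<sigma> k) + t) * (c (\<sigma> k) / c (\<sigma> l)) = q ^ (of_bool (l < k) + t + \<beta> k) / q ^ \<beta> l"
      if "k \<in> I" "l \<in> I" "k \<noteq> l" for k l t
    proof -
      have shift: "of_bool (\<sigma> l < \<sigma> k) + \<delta> (\<sigma> k) = \<delta> (\<sigma> l) + of_bool (l < k)"
        unfolding \<sigma>_def \<delta>_def using that assms(3) by (intro cyc_index_order_shift) (auto simp: I_def)
      have "q ^ (of_bool (\<sigma> l < \<sigma> k) + t) * (c (\<sigma> k) / c (\<sigma> l))
          = q ^ ((of_bool (\<sigma> l < \<sigma> k) + \<delta> (\<sigma> k)) + t + \<beta> k) / q ^ (\<beta> l + \<delta> (\<sigma> l))"
        using that by (simp add: c power_add mult_ac)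
      also have "\<dots> = q ^ (of_bool (l < k) + t + \<beta> k) / q ^ \<beta> l"
        unfolding shift using q(1) by (simp add: power_add)
      finally show ?thesis .
    qed
    then show ?thesis
      unfolding T_def by (subst prod_pairs_reindex[OF bij]) (intro prod.cong refl; auto simp: K)
  qed

  \<comment> \<open>The candidate has exponents \<open>s k\<close> in rotated indices;
    \<open>restrict\<close> makes it a member of \<open>PiE\<close>, so agreement on
    \<open>I\<close> gives equality.\<close>
  define c\<^sub>0 where "c\<^sub>0 = restrict (\<lambda>i. q ^ (s (inv_into I \<sigma> i) + \<delta> i)) I"
  have c0: "c\<^sub>0 (\<sigma> k) = q ^ (s k + \<delta> (\<sigma> k))" if "k \<in> I" for k
    using that \<sigma>I by (simp add: c\<^sub>0_def inv_into_f_f[OF inj])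
  have c0_mem: "c\<^sub>0 \<in> PiE I A"
  proof (rule PiE_I)
    fix i assume "i \<in> I"
    then obtain l where l: "l \<in> I" "i = \<sigma> l" using img by auto
    then have "s l \<le> D i" using bl[of l] by (simp add: D)
    then show "c\<^sub>0 i \<in> A i" unfolding l(2) c0[OF l(1)] A_def using l(2) by auto
  qed (simp add: c\<^sub>0_def)
  have vanish: "c = c\<^sub>0" if c: "c \<in> PiE I A" and nz: "T c \<noteq> 0" for c
  proof -
    have "\<exists>t. t \<le> D (\<sigma> k) \<and> c (\<sigma> k) = q ^ (t + \<delta> (\<sigma> k))" if "k \<in> I" for k
      using PiE_mem[OF c \<sigma>I[OF that]] by (auto simp: A_def)
    then obtain \<beta> where \<beta>: "\<And>k. k \<in> I \<Longrightarrow> \<beta> k \<le> D (\<sigma> k)" "\<And>k. k \<in> I \<Longrightarrow> c (\<sigma> k) = q ^ (\<beta> k + \<delta> (\<sigma> k))"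
      by metis
    have T\<beta>: "T c = (\<Prod>l\<in>I. \<Prod>k\<in>I - {l}. \<Prod>t<b k + of_bool (k = n \<and> l \<le> m).
        1 - q ^ (of_bool (l < k) + t + \<beta> k) / q ^ \<beta> l)"
      by (rule T) (rule \<beta>(2))
    have fac: "1 - q ^ (of_bool (l < k) + t + \<beta> k) / q ^ \<beta> l \<noteq> 0"
      if "k \<in> I" "l \<in> I" "k \<noteq> l" "t < b k + of_bool (k = n \<and> l \<le> m)" for k l t
    proof
      assume "1 - q ^ (of_bool (l < k) + t + \<beta> k) / q ^ \<beta> l = 0"
      then have "T c = 0"
        unfolding T\<beta> using that finI q(1)
        by - (rule prod_zero, simp, rule bexI[of _ l], rule prod_zero, simp, rule bexI[of _ k],
          rule prod_zero, simp, rule bexI[of _ t], auto)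
      then show False using nz by simp
    qed
    have "\<beta> l = (\<Sum>i=1..<l. b i)" if "l \<in> I" for l
    proof (rule unique_surviving_exponents[OF assms(2)])
      fix k assume "k \<in> {1..n}"
      then have "k \<in> I" by (simp add: I_def)
      then show "\<beta> k + b k \<le> (\<Sum>i=1..n. b i) + of_bool (k \<le> m)"
        using \<beta>(1)[of k] bl[of k] by (simp add: D sn I_def)
    next
      fix k l assume kl: "k \<in> {1..n}" "l \<in> {1..n}" "k \<noteq> l" "\<beta> k + of_bool (l < k) \<le> \<beta> l"
      show "\<beta> k + of_bool (l < k) + b k + of_bool (k = n \<and> l \<le> m) \<le> \<beta> l"
      proof (rule ccontr)
        \<comment> \<open>Otherwise \<open>t = \<beta> l - (\<beta> k + of_bool (l < k))\<close>
          indexes a factor whose two powers of \<open>q\<close> coincide, which is zero.\<close>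
        assume "\<not> ?thesis"
        then have "\<beta> l - (\<beta> k + of_bool (l < k)) < b k + of_bool (k = n \<and> l \<le> m)"
          using kl(4) by linarith
        from fac[OF _ _ kl(3) this] kl show False
          using q(1) by (simp add: I_def)
      qed
    qed (use that in \<open>simp add: I_def\<close>)
    then have "c (\<sigma> k) = c\<^sub>0 (\<sigma> k)" if "k \<in> I" for k
      using that by (simp add: \<beta>(2) c0 s_def)
    then have "c i = c\<^sub>0 i" if "i \<in> I" for i using that img by (metis imageE)
    then show ?thesis using PiE_ext[OF c c0_mem] by blast
  qed

  have W0: "W c\<^sub>0 = (\<Prod>l\<in>I. \<Prod>t\<in>{..s (Suc n) - b l + of_bool (l \<le> m)} - {s l}. 1 / (1 - q ^ t / q ^ s l))"
  proof -
    have "W c\<^sub>0 = (\<Prod>l\<in>I. \<Prod>z\<in>A (\<sigma> l) - {c\<^sub>0 (\<sigma> l)}. 1 / (1 - z / c\<^sub>0 (\<sigma> l)))"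
      unfolding W_def by (rule prod.reindex_bij_betw[OF bij, symmetric])
    also have "\<dots> = (\<Prod>l\<in>I. \<Prod>t\<in>{..s (Suc n) - b l + of_bool (l \<le> m)} - {s l}. 1 / (1 - q ^ t / q ^ s l))"
    proof (rule prod.cong[OF refl])
      fix l assume l: "l \<in> I"
      \<comment> \<open>The weights involve only quotients of nodes in the same direction, so the
        offset cancels.\<close>
      have "A (\<sigma> l) - {c\<^sub>0 (\<sigma> l)} = (\<lambda>t. q ^ (t + \<delta> (\<sigma> l))) ` ({..D (\<sigma> l)} - {s l})"
        unfolding A_def c0[OF l] by (auto simp: q(3))
      then have "(\<Prod>z\<in>A (\<sigma> l) - {c\<^sub>0 (\<sigma> l)}. 1 / (1 - z / c\<^sub>0 (\<sigma> l)))
          = (\<Prod>t\<in>{..D (\<sigma> l)} - {s l}. 1 / (1 - q ^ (t + \<delta> (\<sigma> l)) / q ^ (s l + \<delta> (\<sigma> l))))"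
        by (simp only: prod.reindex[OF injA] o_def c0[OF l])
      then show "(\<Prod>z\<in>A (\<sigma> l) - {c\<^sub>0 (\<sigma> l)}. 1 / (1 - z / c\<^sub>0 (\<sigma> l)))
          = (\<Prod>t\<in>{..s (Suc n) - b l + of_bool (l \<le> m)} - {s l}. 1 / (1 - q ^ t / q ^ s l))"
        using q(1) by (simp add: D[OF l] power_add)
    qed
    finally show ?thesis .
  qed

  \<comment> \<open>In the ordered form the additional factor q belongs to the pairs whose numerator
    index is the larger one, hence the exponent \<open>of_bool (j < i)\<close>.\<close>
  have "CT (\<Prod>j\<in>{1..n}. \<Prod>i\<in>{1..<j}.
            qpoch (const_laurent q_ind) (x_quot i j) (astar a r M i j)
          * qpoch (const_laurent q_ind) (const_laurent q_ind * x_quot j i) (astar a r M j i))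
      = CT (\<Prod>j\<in>I. \<Prod>i\<in>I - {j}.
          qpoch (const_laurent q_ind) (const_laurent q_ind ^ of_bool (j < i) * x_quot i j) (K i j))"
    unfolding I_def prod_pairs_below_diagonal[symmetric] K_def
    by (intro arg_cong[where f = CT] prod.cong refl) auto
  also have "\<dots> = (\<Sum>c\<in>PiE I A. T c * W c)"
    unfolding T_def W_def q_def
  proof (rule CT_pair_product[OF finI])
    fix i assume "i \<in> I"
    show "finite (A i) \<and> 0 \<notin> A i \<and> (\<Sum>k\<in>I - {i}. K k i) < card (A i)"
      using q(1) by (auto simp: A_def card_image[OF injA] D_def)
  qed
  also have "\<dots> = (\<Sum>c\<in>{c\<^sub>0}. T c * W c)"
    using c0_mem vanish finI by (intro sum.mono_neutral_right finite_PiE) (auto simp: A_def)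
  also have "\<dots> = T c\<^sub>0 * W c\<^sub>0" by simp
  also have "T c\<^sub>0 = (\<Prod>l\<in>I. \<Prod>k\<in>I - {l}. \<Prod>t<b k + of_bool (k = n \<and> l \<le> m).
        1 - q ^ (of_bool (l < k) + t + s k) / q ^ s l)"
    by (rule T) (rule c0)
  also have "\<dots> * W c\<^sub>0 = (1 - q ^ (1 + s (Suc n))) / (1 - q ^ (1 + (\<Sum>v=Suc m..n. b v)))
       * (qpoch q q (s (Suc n)) / (\<Prod>l=1..n. qpoch q q (b l)))"
    unfolding W0 I_def by (rule surviving_term_value[OF q(1) q(2) assms(2) s_def])
  also have "(\<Sum>v=Suc m..n. b v) = (\<Sum>v\<in>{1..n} - M. a v)"
  proof -
    have "{1..n} - M = \<sigma> ` {Suc m..n}"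
    proof -
      have "I - M = \<sigma> ` (I - {1..m})" using inj mI img unfolding M by (subst inj_on_image_set_diff[of \<sigma> I]) auto
      moreover have "I - {1..m} = {Suc m..n}" by (auto simp: I_def)
      ultimately show ?thesis by (simp add: I_def)
    qed
    moreover have "inj_on \<sigma> {Suc m..n}" by (rule inj_on_subset[OF inj]) (auto simp: I_def)
    ultimately show ?thesis by (simp add: sum.reindex b_def)
  qed
  also have "(\<Prod>l=1..n. qpoch q q (b l)) = (\<Prod>i=1..n. qpoch q q (a i))"
    using prod.reindex_bij_betw[OF bij, of "\<lambda>i. qpoch q q (a i)"] by (simp add: b_def I_def)
  finally show ?thesis
    by (simp add: qmultinomial_def q_def sn' I_def)
qed

end
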